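(* Let $A_1,A_2,B$ be finite groups and let $\phi_1:A_1\to B$ and $\phi_2:A_2\to B$ be surjective homomorphisms. Let $A_1\times_BA_2=\{(a_1,a_2)\in A_1\times A_2:\phi_1(a_1)=\phi_2(a_2)\}$ be the subdirect product of groups and let $\varphi:A_1\times_BA_2\to B$ be the surjective homomorphism $\varphi(a_1,a_2)=\phi_1(a_1)=\phi_2(a_2)$. Let $S_1=\{s_1,\dots,s_n\}$ be a symmetric system of generators of $B$. For $i=1,2$ let $\widetilde S_{1,i}=\{\widetilde s_{1,i},\dots,\widetilde s_{n,i}\}$ be an $S_1$-transversal section of $\phi_i$ with $\phi_i(\widetilde s_{j,i})=s_j$, let $S_{0,i}$ be an admissible symmetric system of generators of $\ker(\phi_i)$, and put $S_{\phi_i}=S_{0,i}\cup\widetilde S_{1,i}$. Set $$\widetilde S_1=\{(\widetilde s_{1,1},\widetilde s_{1,2}),\dots,(\widetilde s_{n,1},\widetilde s_{n,2})\},\qquad S_0=(S_{0,1}\times\{1_{A_2}\})\cup(\{1_{A_1}\}\times S_{0,2}),\qquad S_\varphi=S_0\cup\widetilde S_1.$$ Then $$Cay(A_1\times_BA_2,S_\varphi)=Cay(A_1,S_{\phi_1})\boxplus Cay(A_2,S_{\phi_2}).$$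
   Context: Groups and Cayley graphs. Every generating set considered does not contain the identity. A set $S$ in a group is symmetric if $s\in S$ implies $s^{-1}\in S$. For a finite group $G$ and a symmetric system of generators $S$ with $1_G\notin S$, $Cay(G,S)$ is the (simple undirected) graph with vertex set $G$ and $x\sim y$ iff $y=xs$ for some $s\in S$. For a surjective homomorphism $\phi:A\to B$ of finite groups and a symmetric system of generators $S_1=\{s_1,\dots,s_n\}$ of $B$ (distinct elements), an $S_1$-transversal section of $\phi$ is a symmetric subset $\widetilde S_1=\{\widetilde s_1,\dots,\widetilde s_n\}$ of $A$ with $\phi(\widetilde s_j)=s_j$ for each $j$. A symmetric system of generators $S_0$ of $\ker(\phi)$ is admissible if $aS_0a^{-1}\subseteq S_0$ for every $a\in A$. Subdirect product of graph bundles. In this situation $(Cay(A_i,S_{\phi_i}),\phi_i,Cay(B,S_1))$, $i=1,2$, are graph bundles over the same base $Cay(B,S_1)$, and $\boxplus$ denotes the total space of their subdirect product. In general, for graph bundles $(X_i,p_i,\Gamma)$ (in particular, $p_i:X_i\to\Gamma$ is a map on vertices sending adjacent vertices to adjacent or equal vertices), $X_1\boxplus X_2$ is the graph with vertex set $\{(x,y)\in V_{X_1}\times V_{X_2}:p_1(x)=p_2(y)\}$, and $(x,y)\sim(x',y')$ iff one of: (I) $x=x'$ and $y\sim y'$; (II) $x\sim x'$, $p_1(x)=p_1(x')$ and $y=y'$; (III) $x\sim x'$, $p_1(x)\sim p_1(x')$ and $y\sim y'$. Equality of graphs means equal vertex sets and equal edge sets. *)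

theory Defs
  imports "HOL-Algebra.Algebra" "Graph_Theory.Pair_Digraph"
begin

section \<open>Symmetric systems of generators and Cayley graphs\<close>

definition symmetric_generators :: "('a, 'm) monoid_scheme \<Rightarrow> 'a set \<Rightarrow> bool" where
  "symmetric_generators G S \<longleftrightarrow>
     S \<subseteq> carrier G \<and> \<one>\<^bsub>G\<^esub> \<notin> S \<and> (\<forall>s\<in>S. inv\<^bsub>G\<^esub> s \<in> S) \<and> generate G S = carrier G"

text \<open>
  A simple undirected graph is a \<^const>\<open>pair_graph\<close>: the adjacency relation is the
  irreflexive and symmetric set \<^const>\<open>parcs\<close> of ordered pairs, so that equality of the two
  records is equality of vertex sets together with equality of edge sets.
\<close>

definition cayley_graph :: "('a, 'm) monoid_scheme \<Rightarrow> 'a set \<Rightarrow> 'a pair_pre_digraph" where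
  "cayley_graph G S =
     \<lparr> pverts = carrier G,
       parcs = {(x, y). x \<in> carrier G \<and> y \<in> carrier G \<and> (\<exists>s\<in>S. y = x \<otimes>\<^bsub>G\<^esub> s)} \<rparr>"

section \<open>Transversal sections and admissible generators\<close>

text \<open>
  The base generating set is the family \<open>s 1, \<dots>, s n\<close>, and the section is the family
  \<open>t 1, \<dots>, t n\<close> with the same index set.
\<close>

definition transversal_section ::
  "('a, 'm) monoid_scheme \<Rightarrow> ('a \<Rightarrow> 'b) \<Rightarrow> nat \<Rightarrow> (nat \<Rightarrow> 'b) \<Rightarrow> (nat \<Rightarrow> 'a) \<Rightarrow> bool" where
  "transversal_section A \<phi> n s t \<longleftrightarrow>
     (\<forall>j\<in>{1..n}. t j \<in> carrier A \<and> \<phi> (t j) = s j) \<and>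
     (\<forall>x\<in>t ` {1..n}. inv\<^bsub>A\<^esub> x \<in> t ` {1..n})"

definition admissible_kernel_generators ::
  "('a, 'm) monoid_scheme \<Rightarrow> ('b, 'k) monoid_scheme \<Rightarrow> ('a \<Rightarrow> 'b) \<Rightarrow> 'a set \<Rightarrow> bool" where
  "admissible_kernel_generators A B \<phi> S0 \<longleftrightarrow>
     symmetric_generators (A\<lparr>carrier := kernel A B \<phi>\<rparr>) S0 \<and>
     (\<forall>a\<in>carrier A. (\<lambda>x. a \<otimes>\<^bsub>A\<^esub> x \<otimes>\<^bsub>A\<^esub> inv\<^bsub>A\<^esub> a) ` S0 \<subseteq> S0)"

section \<open>Subdirect products\<close>

definition subdirect_group ::
  "('a, 'm) monoid_scheme \<Rightarrow> ('a \<Rightarrow> 'c) \<Rightarrow> ('b, 'k) monoid_scheme \<Rightarrow> ('b \<Rightarrow> 'c) \<Rightarrow> ('a \<times> 'b) monoid"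
where
  "subdirect_group A1 \<phi>1 A2 \<phi>2 =
     (A1 \<times>\<times> A2)\<lparr>carrier := {(a1, a2) \<in> carrier A1 \<times> carrier A2. \<phi>1 a1 = \<phi>2 a2}\<rparr>"

text \<open>
  The total space of the subdirect product of \<open>(X1, p1, \<Gamma>)\<close> and \<open>(X2, p2, \<Gamma>)\<close>.  The three
  disjuncts are the adjacencies along the fibre of \<open>X2\<close>, along the fibre of \<open>X1\<close>, and over an
  edge of \<open>\<Gamma>\<close>.
\<close>

definition subdirect_graph ::
  "'a pair_pre_digraph \<Rightarrow> ('a \<Rightarrow> 'c) \<Rightarrow> 'b pair_pre_digraph \<Rightarrow> ('b \<Rightarrow> 'c) \<Rightarrow> 'c pair_pre_digraph
     \<Rightarrow> ('a \<times> 'b) pair_pre_digraph"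
where
  "subdirect_graph X1 p1 X2 p2 \<Gamma> =
     (let V = {(x, y) \<in> pverts X1 \<times> pverts X2. p1 x = p2 y} in
      \<lparr> pverts = V,
        parcs = {((x, y), (x', y')). (x, y) \<in> V \<and> (x', y') \<in> V \<and>
          (x = x' \<and> (y, y') \<in> parcs X2 \<or>
           (x, x') \<in> parcs X1 \<and> p1 x = p1 x' \<and> y = y' \<or>
           (x, x') \<in> parcs X1 \<and> (p1 x, p1 x') \<in> parcs \<Gamma> \<and> (y, y') \<in> parcs X2)} \<rparr>)"

section \<open>Well-definedness\<close>

lemma pair_graph_cayley_graph:
  assumes G: "group G" and fin: "finite (carrier G)" and S: "symmetric_generators G S"
  shows "pair_graph (cayley_graph G S)"
proof -
  interpret group G by fact
  have sub: "S \<subseteq> carrier G" and one: "\<one>\<^bsub>G\<^esub> \<notin> S" and inv: "\<And>s. s \<in> S \<Longrightarrow> inv\<^bsub>G\<^esub> s \<in> S"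
    using S by (auto simp: symmetric_generators_def)
  let ?X = "cayley_graph G S"
  have finite_arcs: "finite (parcs ?X)"
    by (rule finite_subset[of _ "carrier G \<times> carrier G"]) (auto simp: cayley_graph_def fin)
  have loopfree: "fst e \<noteq> snd e" if "e \<in> parcs ?X" for e
    using that sub one by (auto simp: cayley_graph_def)
  have sym: "(y, x) \<in> parcs ?X" if xy: "(x, y) \<in> parcs ?X" for x y
  proof -
    obtain s where s: "s \<in> S" "y = x \<otimes>\<^bsub>G\<^esub> s" "x \<in> carrier G"
      using xy by (auto simp: cayley_graph_def)
    then have "x = y \<otimes>\<^bsub>G\<^esub> inv\<^bsub>G\<^esub> s" using sub by (auto simp: m_assoc)
    then show ?thesis using s inv[OF s(1)] xy by (auto simp: cayley_graph_def)
  qed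
  have verts: "fst e \<in> pverts ?X" "snd e \<in> pverts ?X" if "e \<in> parcs ?X" for e
    using that by (auto simp: cayley_graph_def)
  have "finite (pverts ?X)" by (simp add: cayley_graph_def fin)
  moreover have "Relation.sym (parcs ?X)" using sym by (rule symI)
  ultimately show ?thesis
    by unfold_locales (use verts finite_arcs loopfree in \<open>simp_all add: symmetric_def\<close>)
qed

lemma pair_graph_subdirect_graph:
  assumes "pair_graph X1" "pair_graph X2" "pair_graph \<Gamma>"
  shows "pair_graph (subdirect_graph X1 p1 X2 p2 \<Gamma>)"
proof -
  interpret X1: pair_graph X1 by fact
  interpret X2: pair_graph X2 by fact
  interpret Y: pair_graph \<Gamma> by fact
  let ?X = "subdirect_graph X1 p1 X2 p2 \<Gamma>"
  have fin: "finite (pverts ?X)"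
    by (rule finite_subset[of _ "pverts X1 \<times> pverts X2"])
      (auto simp: subdirect_graph_def X1.pair_finite_verts X2.pair_finite_verts)
  have verts: "fst e \<in> pverts ?X" "snd e \<in> pverts ?X" if "e \<in> parcs ?X" for e
    using that by (auto simp: subdirect_graph_def Let_def)
  have fin': "finite (parcs ?X)"
    by (rule finite_subset[of _ "pverts ?X \<times> pverts ?X"]) (use verts fin in force)+
  have loopfree: "fst e \<noteq> snd e" if "e \<in> parcs ?X" for e
    using that X1.pair_no_loops X2.pair_no_loops
    by (fastforce simp: subdirect_graph_def Let_def)
  have "sym (parcs X1)" "sym (parcs X2)" "sym (parcs \<Gamma>)"
    using X1.pair_sym_arcs X2.pair_sym_arcs Y.pair_sym_arcs by (auto simp: symmetric_def)
  then have "sym (parcs ?X)"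
    unfolding sym_def subdirect_graph_def Let_def by auto
  then show ?thesis
    by unfold_locales (use verts fin fin' loopfree in \<open>auto simp: symmetric_def\<close>)
qed

lemma symmetric_generators_extension:
  assumes A: "group A" and B: "group B" and \<phi>: "\<phi> \<in> epi A B"
    and S1: "symmetric_generators B (s ` {1..n})"
    and t: "transversal_section A \<phi> n s t"
    and S0: "admissible_kernel_generators A B \<phi> S0"
  shows "symmetric_generators A (S0 \<union> t ` {1..n})"
proof -
  interpret group_hom A B \<phi>
    using A B \<phi> by (simp add: group_hom_def group_hom_axioms_def epi_def)
  let ?K = "kernel A B \<phi>" let ?S = "S0 \<union> t ` {1..n}"
  have K: "subgroup ?K A" by (rule subgroup_kernel)
  have Ksub: "?K \<subseteq> carrier A" by (auto simp: kernel_def)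
  have S0K: "S0 \<subseteq> ?K" and one0: "\<one>\<^bsub>A\<^esub> \<notin> S0" and gen0: "generate A S0 = ?K"
    and inv0: "\<And>x. x \<in> S0 \<Longrightarrow> inv\<^bsub>A\<^esub> x \<in> S0"
    using S0 G.generate_consistent[OF _ K, of S0] G.m_inv_consistent[OF K]
    by (auto simp: admissible_kernel_generators_def symmetric_generators_def subset_iff)
  have tc: "t ` {1..n} \<subseteq> carrier A" and \<phi>t: "\<And>j. j \<in> {1..n} \<Longrightarrow> \<phi> (t j) = s j"
    and invt: "\<And>x. x \<in> t ` {1..n} \<Longrightarrow> inv\<^bsub>A\<^esub> x \<in> t ` {1..n}"
    using t by (auto simp: transversal_section_def)
  have one1: "\<one>\<^bsub>B\<^esub> \<notin> s ` {1..n}" and gen1: "generate B (s ` {1..n}) = carrier B"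
    using S1 by (auto simp: symmetric_generators_def)
  have Sc: "?S \<subseteq> carrier A" using S0K Ksub tc by auto
  have one: "\<one>\<^bsub>A\<^esub> \<notin> ?S"
  proof
    assume "\<one>\<^bsub>A\<^esub> \<in> ?S"
    then obtain j where "j \<in> {1..n}" "t j = \<one>\<^bsub>A\<^esub>" using one0 by force
    then show False using \<phi>t[of j] one1 by (metis hom_one imageI)
  qed
  let ?H = "generate A ?S"
  have H: "subgroup ?H A" by (rule G.generate_is_subgroup[OF Sc])
  have "carrier A \<subseteq> ?H"
  proof
    fix a assume a: "a \<in> carrier A"
    have "s ` {1..n} \<subseteq> \<phi> ` ?S" using \<phi>t by force
    then have "carrier B \<subseteq> generate B (\<phi> ` ?S)"
      using gen1 H.mono_generate by metis
    also have "\<dots> = \<phi> ` ?H" using generate_img[OF Sc] by simp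
    finally have "\<phi> a \<in> \<phi> ` ?H" using hom_closed[OF a] by (rule subsetD)
    then obtain h where h: "h \<in> ?H" "\<phi> h = \<phi> a" by (elim imageE) simp
    have hc: "h \<in> carrier A" using H h(1) by (rule subgroup.mem_carrier)
    have "a \<otimes>\<^bsub>A\<^esub> inv\<^bsub>A\<^esub> h \<in> ?K" using a hc h by (simp add: kernel_def)
    then have "a \<otimes>\<^bsub>A\<^esub> inv\<^bsub>A\<^esub> h \<in> ?H"
      using gen0 G.mono_generate[of S0 ?S] by blast
    then have "(a \<otimes>\<^bsub>A\<^esub> inv\<^bsub>A\<^esub> h) \<otimes>\<^bsub>A\<^esub> h \<in> ?H"
      using h(1) by (rule subgroup.m_closed[OF H])
    then show "a \<in> ?H" using a hc by (simp add: G.m_assoc)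
  qed
  then have "?H = carrier A" using subgroup.subset[OF H] by auto
  moreover have "\<forall>x\<in>?S. inv\<^bsub>A\<^esub> x \<in> ?S" using inv0 invt by blast
  ultimately show ?thesis unfolding symmetric_generators_def using Sc one by (intro conjI)
qed

context
  fixes A1 :: "('a, 'm) monoid_scheme" and A2 :: "('b, 'k) monoid_scheme"
    and B :: "('c, 'l) monoid_scheme"
    and \<phi>1 :: "'a \<Rightarrow> 'c" and \<phi>2 :: "'b \<Rightarrow> 'c"
  assumes A1: "group A1" and A2: "group A2" and B: "group B"
    and epi1: "\<phi>1 \<in> epi A1 B" and epi2: "\<phi>2 \<in> epi A2 B"
begin

interpretation h1: group_hom A1 B \<phi>1
  using A1 B epi1 by (simp add: group_hom_def group_hom_axioms_def epi_def)

interpretation h2: group_hom A2 B \<phi>2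
  using A2 B epi2 by (simp add: group_hom_def group_hom_axioms_def epi_def)

interpretation D: group "A1 \<times>\<times> A2"
  by (rule DirProd_group) (rule A1 A2)+

lemma subgroup_subdirect: "subgroup (carrier (subdirect_group A1 \<phi>1 A2 \<phi>2)) (A1 \<times>\<times> A2)"
proof (rule D.subgroupI)
  have "(\<one>\<^bsub>A1\<^esub>, \<one>\<^bsub>A2\<^esub>) \<in> carrier (subdirect_group A1 \<phi>1 A2 \<phi>2)"
    by (simp add: subdirect_group_def)
  then show "carrier (subdirect_group A1 \<phi>1 A2 \<phi>2) \<noteq> {}" by blast
qed (auto simp: subdirect_group_def A1 A2)

lemma group_subdirect_group: "group (subdirect_group A1 \<phi>1 A2 \<phi>2)"
  using subgroup.subgroup_is_group[OF subgroup_subdirect D.group_axioms]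
  by (simp add: subdirect_group_def)

lemma inv_subdirect_group:
  assumes "(a1, a2) \<in> carrier (subdirect_group A1 \<phi>1 A2 \<phi>2)"
  shows "inv\<^bsub>subdirect_group A1 \<phi>1 A2 \<phi>2\<^esub> (a1, a2) = (inv\<^bsub>A1\<^esub> a1, inv\<^bsub>A2\<^esub> a2)"
  using D.m_inv_consistent[OF subgroup_subdirect] assms
  by (simp add: subdirect_group_def A1 A2)

lemma epi_subdirect_projection: "\<phi>1 \<circ> fst \<in> epi (subdirect_group A1 \<phi>1 A2 \<phi>2) B"
proof -
  have "b \<in> (\<phi>1 \<circ> fst) ` carrier (subdirect_group A1 \<phi>1 A2 \<phi>2)" if b: "b \<in> carrier B" for b
  proof -
    have "b \<in> \<phi>1 ` carrier A1" "b \<in> \<phi>2 ` carrier A2" using b epi1 epi2 by (simp_all add: epi_def)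
    then obtain a1 a2 where a: "a1 \<in> carrier A1" "b = \<phi>1 a1" "a2 \<in> carrier A2" "b = \<phi>2 a2"
      by (elim imageE)
    then have "(a1, a2) \<in> carrier (subdirect_group A1 \<phi>1 A2 \<phi>2)"
      by (simp add: subdirect_group_def)
    then show ?thesis using a(2) by (intro image_eqI[of _ _ "(a1, a2)"]) simp_all
  qed
  moreover have "\<phi>1 \<circ> fst \<in> hom (subdirect_group A1 \<phi>1 A2 \<phi>2) B"
    by (rule homI) (auto simp: subdirect_group_def)
  ultimately show ?thesis unfolding epi_iff_subset by blast
qed

lemma transversal_section_subdirect:
  assumes inj: "inj_on s {1..n}"
    and t1: "transversal_section A1 \<phi>1 n s t1" and t2: "transversal_section A2 \<phi>2 n s t2"
  shows "transversal_section (subdirect_group A1 \<phi>1 A2 \<phi>2) (\<phi>1 \<circ> fst) n s (\<lambda>j. (t1 j, t2 j))"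
proof -
  let ?P = "subdirect_group A1 \<phi>1 A2 \<phi>2"
  have c: "(t1 j, t2 j) \<in> carrier ?P" if "j \<in> {1..n}" for j
    using that t1 t2 by (auto simp: transversal_section_def subdirect_group_def)
  have "inv\<^bsub>?P\<^esub> (t1 j, t2 j) \<in> (\<lambda>j. (t1 j, t2 j)) ` {1..n}" if j: "j \<in> {1..n}" for j
  proof -
    have "inv\<^bsub>A1\<^esub> t1 j \<in> t1 ` {1..n}" "inv\<^bsub>A2\<^esub> t2 j \<in> t2 ` {1..n}"
      using j t1 t2 unfolding transversal_section_def by blast+
    then obtain k l where k: "k \<in> {1..n}" "inv\<^bsub>A1\<^esub> t1 j = t1 k"
      and l: "l \<in> {1..n}" "inv\<^bsub>A2\<^esub> t2 j = t2 l"
      by (elim imageE)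
    have "\<phi>1 (t1 k) = s k" "\<phi>1 (t1 j) = s j" "t1 j \<in> carrier A1"
      using k(1) j t1 unfolding transversal_section_def by blast+
    then have "s k = inv\<^bsub>B\<^esub> s j" using h1.hom_inv[of "t1 j"] k(2) by simp
    moreover have "\<phi>2 (t2 l) = s l" "\<phi>2 (t2 j) = s j" "t2 j \<in> carrier A2"
      using l(1) j t2 unfolding transversal_section_def by blast+
    then have "s l = inv\<^bsub>B\<^esub> s j" using h2.hom_inv[of "t2 j"] l(2) by simp
    ultimately have "k = l" using inj_onD[OF inj _ k(1) l(1)] by simp
    then show ?thesis using inv_subdirect_group[OF c[OF j]] k l by auto
  qed
  then show ?thesis using c t1 by (auto simp: transversal_section_def)
qed

lemma admissible_kernel_generators_subdirect:
  assumes S1: "admissible_kernel_generators A1 B \<phi>1 S1"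
    and S2: "admissible_kernel_generators A2 B \<phi>2 S2"
  shows "admissible_kernel_generators (subdirect_group A1 \<phi>1 A2 \<phi>2) B (\<phi>1 \<circ> fst)
           (S1 \<times> {\<one>\<^bsub>A2\<^esub>} \<union> {\<one>\<^bsub>A1\<^esub>} \<times> S2)"
proof -
  let ?P = "subdirect_group A1 \<phi>1 A2 \<phi>2"
  let ?S = "S1 \<times> {\<one>\<^bsub>A2\<^esub>} \<union> {\<one>\<^bsub>A1\<^esub>} \<times> S2"
  let ?K = "kernel ?P B (\<phi>1 \<circ> fst)"
  interpret P: group ?P by (rule group_subdirect_group)
  interpret hP: group_hom ?P B "\<phi>1 \<circ> fst"
    using B epi_subdirect_projection P.group_axioms
    by (simp add: group_hom_def group_hom_axioms_def epi_def)
  have K: "?K = kernel A1 B \<phi>1 \<times> kernel A2 B \<phi>2"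
    by (auto simp: kernel_def subdirect_group_def)
  have multP: "(x, y) \<otimes>\<^bsub>?P\<^esub> (x', y') = (x \<otimes>\<^bsub>A1\<^esub> x', y \<otimes>\<^bsub>A2\<^esub> y')" for x y x' y'
    by (simp add: subdirect_group_def)
  have oneP: "\<one>\<^bsub>?P\<^esub> = (\<one>\<^bsub>A1\<^esub>, \<one>\<^bsub>A2\<^esub>)" by (simp add: subdirect_group_def)
  have s1: "S1 \<subseteq> kernel A1 B \<phi>1" "\<one>\<^bsub>A1\<^esub> \<notin> S1" "generate A1 S1 = kernel A1 B \<phi>1"
    "\<And>x. x \<in> S1 \<Longrightarrow> inv\<^bsub>A1\<^esub> x \<in> S1"
    using S1 h1.G.generate_consistent[OF _ h1.subgroup_kernel, of S1]
      h1.G.m_inv_consistent[OF h1.subgroup_kernel]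
    by (auto simp: admissible_kernel_generators_def symmetric_generators_def subset_iff)
  have s2: "S2 \<subseteq> kernel A2 B \<phi>2" "\<one>\<^bsub>A2\<^esub> \<notin> S2" "generate A2 S2 = kernel A2 B \<phi>2"
    "\<And>x. x \<in> S2 \<Longrightarrow> inv\<^bsub>A2\<^esub> x \<in> S2"
    using S2 h2.G.generate_consistent[OF _ h2.subgroup_kernel, of S2]
      h2.G.m_inv_consistent[OF h2.subgroup_kernel]
    by (auto simp: admissible_kernel_generators_def symmetric_generators_def subset_iff)
  have ker1: "x \<in> kernel A1 B \<phi>1 \<Longrightarrow> (x, \<one>\<^bsub>A2\<^esub>) \<in> carrier ?P" for x
    by (auto simp: kernel_def subdirect_group_def)
  have ker2: "y \<in> kernel A2 B \<phi>2 \<Longrightarrow> (\<one>\<^bsub>A1\<^esub>, y) \<in> carrier ?P" for y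
    by (auto simp: kernel_def subdirect_group_def)
  have inv1: "x \<in> S1 \<Longrightarrow> inv\<^bsub>?P\<^esub> (x, \<one>\<^bsub>A2\<^esub>) = (inv\<^bsub>A1\<^esub> x, \<one>\<^bsub>A2\<^esub>)" for x
    using inv_subdirect_group[OF ker1] s1(1) by auto
  have inv2: "y \<in> S2 \<Longrightarrow> inv\<^bsub>?P\<^esub> (\<one>\<^bsub>A1\<^esub>, y) = (\<one>\<^bsub>A1\<^esub>, inv\<^bsub>A2\<^esub> y)" for y
    using inv_subdirect_group[OF ker2] s2(1) by auto
  have g1: "(x, \<one>\<^bsub>A2\<^esub>) \<in> generate ?P ?S" if "x \<in> generate A1 S1" for x
    using that
  proof induction
    case one then show ?case using generate.one[of ?P ?S] by (simp add: oneP)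
  next
    case (incl h) then show ?case by (auto intro: generate.incl)
  next
    case (inv h) then show ?case using s1(4) by (auto intro: generate.incl)
  next
    case (eng h h')
    then show ?case using generate.eng[OF eng.IH] by (simp add: multP)
  qed
  have g2: "(\<one>\<^bsub>A1\<^esub>, y) \<in> generate ?P ?S" if "y \<in> generate A2 S2" for y
    using that
  proof induction
    case one then show ?case using generate.one[of ?P ?S] by (simp add: oneP)
  next
    case (incl h) then show ?case by (auto intro: generate.incl)
  next
    case (inv h) then show ?case using s2(4) by (auto intro: generate.incl)
  next
    case (eng h h')
    then show ?case using generate.eng[OF eng.IH] by (simp add: multP)
  qed
  have SK: "?S \<subseteq> ?K" unfolding K using s1(1) s2(1) by (auto simp: kernel_def)
  have "(x, y) \<in> generate ?P ?S" if "(x, y) \<in> ?K" for x y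
  proof -
    have "x \<in> generate A1 S1" "y \<in> generate A2 S2" using that s1(3) s2(3) by (simp_all add: K)
    moreover have "x \<in> carrier A1" "y \<in> carrier A2"
      using that unfolding K by (simp_all add: kernel_def)
    ultimately show ?thesis using generate.eng[OF g1 g2, of x y] by (simp add: multP)
  qed
  then have gen: "generate ?P ?S = ?K"
    using P.generate_subgroup_incl[OF SK hP.subgroup_kernel] by auto
  have invS: "inv\<^bsub>?P\<^esub> z \<in> ?S" if "z \<in> ?S" for z
    using that s1(4) s2(4) inv1 inv2 by auto
  have sg: "symmetric_generators (?P\<lparr>carrier := ?K\<rparr>) ?S"
    unfolding symmetric_generators_def
  proof (intro conjI ballI)
    show "?S \<subseteq> carrier (?P\<lparr>carrier := ?K\<rparr>)" using SK by simp
    show "\<one>\<^bsub>?P\<lparr>carrier := ?K\<rparr>\<^esub> \<notin> ?S" using s1(2) s2(2) by (simp add: oneP)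
    show "inv\<^bsub>?P\<lparr>carrier := ?K\<rparr>\<^esub> z \<in> ?S" if "z \<in> ?S" for z
      using P.m_inv_consistent[OF hP.subgroup_kernel subsetD[OF SK that]] invS[OF that]
      by (simp only:)
    show "generate (?P\<lparr>carrier := ?K\<rparr>) ?S = carrier (?P\<lparr>carrier := ?K\<rparr>)"
      using P.generate_consistent[OF SK hP.subgroup_kernel] gen by simp
  qed
  have a1: "a \<otimes>\<^bsub>A1\<^esub> x \<otimes>\<^bsub>A1\<^esub> inv\<^bsub>A1\<^esub> a \<in> S1" if "a \<in> carrier A1" "x \<in> S1" for a x
    using S1 that by (auto simp: admissible_kernel_generators_def)
  have a2: "a \<otimes>\<^bsub>A2\<^esub> x \<otimes>\<^bsub>A2\<^esub> inv\<^bsub>A2\<^esub> a \<in> S2" if "a \<in> carrier A2" "x \<in> S2" for a x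
    using S2 that by (auto simp: admissible_kernel_generators_def)
  have "(a \<otimes>\<^bsub>?P\<^esub> z) \<otimes>\<^bsub>?P\<^esub> inv\<^bsub>?P\<^esub> a \<in> ?S" if a: "a \<in> carrier ?P" and z: "z \<in> ?S" for a z
  proof -
    obtain u v where uv: "a = (u, v)" by (cases a)
    have c: "u \<in> carrier A1" "v \<in> carrier A2" using a uv by (auto simp: subdirect_group_def)
    have i: "inv\<^bsub>?P\<^esub> (u, v) = (inv\<^bsub>A1\<^esub> u, inv\<^bsub>A2\<^esub> v)" using a uv inv_subdirect_group by simp
    from z show ?thesis
    proof
      assume "z \<in> S1 \<times> {\<one>\<^bsub>A2\<^esub>}"
      then obtain x where "x \<in> S1" "z = (x, \<one>\<^bsub>A2\<^esub>)" by blast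
      then show ?thesis using a1[OF c(1)] c by (simp add: uv i multP)
    next
      assume "z \<in> {\<one>\<^bsub>A1\<^esub>} \<times> S2"
      then obtain y where "y \<in> S2" "z = (\<one>\<^bsub>A1\<^esub>, y)" by blast
      then show ?thesis using a2[OF c(2)] c by (simp add: uv i multP)
    qed
  qed
  then have "(\<lambda>z. a \<otimes>\<^bsub>?P\<^esub> z \<otimes>\<^bsub>?P\<^esub> inv\<^bsub>?P\<^esub> a) ` ?S \<subseteq> ?S" if "a \<in> carrier ?P" for a
    using that by (intro image_subsetI)
  with sg show ?thesis unfolding admissible_kernel_generators_def by (intro conjI ballI)
qed

lemma symmetric_generators_subdirect:
  assumes "inj_on s {1..n}" and "symmetric_generators B (s ` {1..n})"
    and "transversal_section A1 \<phi>1 n s t1" and "transversal_section A2 \<phi>2 n s t2"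
    and "admissible_kernel_generators A1 B \<phi>1 S1"
    and "admissible_kernel_generators A2 B \<phi>2 S2"
  shows "symmetric_generators (subdirect_group A1 \<phi>1 A2 \<phi>2)
           ((S1 \<times> {\<one>\<^bsub>A2\<^esub>} \<union> {\<one>\<^bsub>A1\<^esub>} \<times> S2) \<union> (\<lambda>j. (t1 j, t2 j)) ` {1..n})"
  by (rule symmetric_generators_extension[OF group_subdirect_group B epi_subdirect_projection
        assms(2) transversal_section_subdirect[OF assms(1,3,4)]
        admissible_kernel_generators_subdirect[OF assms(5,6)]])

end

lemma cayley_graph_projection:
  assumes A: "group A" and B: "group B" and \<phi>: "\<phi> \<in> epi A B"
    and t: "transversal_section A \<phi> n s t" and S0: "admissible_kernel_generators A B \<phi> S0"
    and xy: "(x, y) \<in> parcs (cayley_graph A (S0 \<union> t ` {1..n}))"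
  shows "\<phi> x = \<phi> y \<or> (\<phi> x, \<phi> y) \<in> parcs (cayley_graph B (s ` {1..n}))"
proof -
  interpret group_hom A B \<phi>
    using A B \<phi> by (simp add: group_hom_def group_hom_axioms_def epi_def)
  have S0': "S0 \<subseteq> kernel A B \<phi>"
    using S0 by (auto simp: admissible_kernel_generators_def symmetric_generators_def)
  obtain u where u: "u \<in> S0 \<union> t ` {1..n}" "y = x \<otimes>\<^bsub>A\<^esub> u" "x \<in> carrier A" "y \<in> carrier A"
    using xy by (auto simp: cayley_graph_def)
  show ?thesis
  proof (cases "u \<in> S0")
    case True
    then have "u \<in> carrier A" "\<phi> u = \<one>\<^bsub>B\<^esub>" using S0' by (auto simp: kernel_def)
    then show ?thesis using u by simp
  next
    case False
    then obtain j where j: "j \<in> {1..n}" "u = t j" using u by auto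
    then have "u \<in> carrier A" "\<phi> u = s j" using t by (auto simp: transversal_section_def)
    then have "\<phi> y = \<phi> x \<otimes>\<^bsub>B\<^esub> s j" using u by simp
    moreover have "\<phi> x \<in> carrier B" "\<phi> y \<in> carrier B" using u by simp_all
    ultimately show ?thesis using j by (auto simp: cayley_graph_def)
  qed
qed

end

theory Submission
  imports Defs
begin

text \<open>
  An arc of a Cayley graph with generators \<open>S0 \<union> t ` {1..n}\<close> stays in a fibre exactly when its
  label lies in \<open>S0\<close>, and lies over an arc of the base exactly when its label is some \<open>t j\<close>,
  because \<open>S0\<close> maps to the identity and no \<open>s j\<close> is the identity. Adjacency types (I) and (II) thus
  correspond to the labels in \<open>{\<one>} \<times> S02\<close> and \<open>S01 \<times> {\<one>}\<close>. In type (III) the two labels \<open>t1 j\<close> and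
  \<open>t2 k\<close> lie over the same base element, so \<open>j = k\<close> by injectivity of \<open>s\<close>.
\<close>

context
  fixes A :: "('a, 'm) monoid_scheme" and B :: "('c, 'l) monoid_scheme" and \<phi> :: "'a \<Rightarrow> 'c"
    and n :: nat and s :: "nat \<Rightarrow> 'c" and t :: "nat \<Rightarrow> 'a" and S0 :: "'a set"
  assumes A: "group A" and B: "group B" and \<phi>: "\<phi> \<in> epi A B"
    and S1: "symmetric_generators B (s ` {1..n})"
    and t: "transversal_section A \<phi> n s t"
    and S0: "admissible_kernel_generators A B \<phi> S0"
begin

interpretation group_hom A B \<phi>
  using A B \<phi> by (simp add: group_hom_def group_hom_axioms_def epi_def)

lemma kernel_generator:
  assumes "u \<in> S0"
  shows "u \<in> carrier A" and "\<phi> u = \<one>\<^bsub>B\<^esub>"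
  using S0 assms
  by (auto simp: admissible_kernel_generators_def symmetric_generators_def kernel_def)

lemma section_generator:
  assumes "j \<in> {1..n}"
  shows "t j \<in> carrier A" and "\<phi> (t j) = s j" and "s j \<in> carrier B" and "s j \<noteq> \<one>\<^bsub>B\<^esub>"
proof -
  show "t j \<in> carrier A" "\<phi> (t j) = s j"
    using t assms by (auto simp: transversal_section_def)
  show "s j \<in> carrier B" using S1 assms by (auto simp: symmetric_generators_def)
  have "s j \<in> s ` {1..n}" using assms by (rule imageI)
  then show "s j \<noteq> \<one>\<^bsub>B\<^esub>" using S1 unfolding symmetric_generators_def by metis
qed

text \<open>Right translation by \<open>u\<close> changes the projection by the factor
  \<open>\<phi> u\<close>, so by cancellation in \<open>B\<close> an arc stays in its fibre iff its
  label has trivial image. This form turns adjacency types (I) and (II) into statements about labels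
  only.\<close>

lemma cayley_graph_arc_in_fibre:
  "(x, x') \<in> parcs (cayley_graph A (S0 \<union> t ` {1..n})) \<and> \<phi> x = \<phi> x' \<longleftrightarrow>
     x \<in> carrier A \<and> (\<exists>u\<in>S0. x' = x \<otimes>\<^bsub>A\<^esub> u)"
proof -
  have "\<phi> (x \<otimes>\<^bsub>A\<^esub> t j) \<noteq> \<phi> x" if "x \<in> carrier A" "j \<in> {1..n}" for j
    using that section_generator[OF that(2)] by simp
  moreover have "\<phi> (x \<otimes>\<^bsub>A\<^esub> u) = \<phi> x" if "x \<in> carrier A" "u \<in> S0" for u
    using that kernel_generator[OF that(2)] by simp
  ultimately show ?thesis
    using kernel_generator(1) unfolding cayley_graph_def by (auto; metis)
qed

lemma cayley_graph_arc_over_arc: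
  "(x, x') \<in> parcs (cayley_graph A (S0 \<union> t ` {1..n})) \<and>
     (\<phi> x, \<phi> x') \<in> parcs (cayley_graph B (s ` {1..n})) \<longleftrightarrow>
     x \<in> carrier A \<and> (\<exists>j\<in>{1..n}. x' = x \<otimes>\<^bsub>A\<^esub> t j)"
  (is "?L \<longleftrightarrow> ?R")
proof
  assume L: ?L
  then obtain j where j: "j \<in> {1..n}" "\<phi> x' = \<phi> x \<otimes>\<^bsub>B\<^esub> s j" and x: "x \<in> carrier A"
    by (auto simp: cayley_graph_def)
  \<comment> \<open>The index \<open>j\<close> read off the base arc serves only to show that the
    projection moves. A label in \<open>S0\<close> would keep it fixed, so the label of the arc in
    the total graph must come from the section.\<close>
  have "\<phi> x \<noteq> \<phi> x'" using j x section_generator[OF j(1)] by simp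
  then show ?R
    using L cayley_graph_arc_in_fibre[of x x'] by (auto simp: cayley_graph_def)
next
  assume ?R
  then obtain j where x: "x \<in> carrier A" and j: "j \<in> {1..n}" "x' = x \<otimes>\<^bsub>A\<^esub> t j" by blast
  then have "\<phi> x' = \<phi> x \<otimes>\<^bsub>B\<^esub> s j" using section_generator[OF j(1)] by simp
  then show ?L using x j section_generator[OF j(1)] by (auto simp: cayley_graph_def)
qed

lemma section_translate:
  assumes "x \<in> carrier A" and "j \<in> {1..n}"
  shows "\<phi> (x \<otimes>\<^bsub>A\<^esub> t j) = \<phi> x \<otimes>\<^bsub>B\<^esub> s j"
  using assms section_generator[OF assms(2)] by simp

end

theorem theorem5p9:
  fixes A1 :: "('a, 'm) monoid_scheme" and A2 :: "('b, 'k) monoid_scheme"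
    and B :: "('c, 'l) monoid_scheme"
    and \<phi>1 :: "'a \<Rightarrow> 'c" and \<phi>2 :: "'b \<Rightarrow> 'c"
    and n :: nat and s :: "nat \<Rightarrow> 'c" and t1 :: "nat \<Rightarrow> 'a" and t2 :: "nat \<Rightarrow> 'b"
    and S01 :: "'a set" and S02 :: "'b set"
  assumes "group A1" and "finite (carrier A1)"
    and "group A2" and "finite (carrier A2)"
    and "group B" and "finite (carrier B)"
    and "\<phi>1 \<in> epi A1 B" and "\<phi>2 \<in> epi A2 B"
    and "inj_on s {1..n}" and "symmetric_generators B (s ` {1..n})"
    and "transversal_section A1 \<phi>1 n s t1"
    and "transversal_section A2 \<phi>2 n s t2"
    and "admissible_kernel_generators A1 B \<phi>1 S01"
    and "admissible_kernel_generators A2 B \<phi>2 S02"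
  shows "let S\<phi>1 = S01 \<union> t1 ` {1..n};
             S\<phi>2 = S02 \<union> t2 ` {1..n};
             S1t = (\<lambda>j. (t1 j, t2 j)) ` {1..n};
             S0 = (S01 \<times> {\<one>\<^bsub>A2\<^esub>}) \<union> ({\<one>\<^bsub>A1\<^esub>} \<times> S02);
             S\<phi> = S0 \<union> S1t
         in cayley_graph (subdirect_group A1 \<phi>1 A2 \<phi>2) S\<phi> =
            subdirect_graph (cayley_graph A1 S\<phi>1) \<phi>1 (cayley_graph A2 S\<phi>2) \<phi>2
              (cayley_graph B (s ` {1..n}))"
proof -
  interpret A1: group A1 by fact
  interpret A2: group A2 by fact
  interpret B: group B by fact
  let ?P = "subdirect_group A1 \<phi>1 A2 \<phi>2"
  let ?X1 = "cayley_graph A1 (S01 \<union> t1 ` {1..n})"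
  let ?X2 = "cayley_graph A2 (S02 \<union> t2 ` {1..n})"
  let ?Y = "cayley_graph B (s ` {1..n})"
  let ?S = "(S01 \<times> {\<one>\<^bsub>A2\<^esub>}) \<union> ({\<one>\<^bsub>A1\<^esub>} \<times> S02) \<union> (\<lambda>j. (t1 j, t2 j)) ` {1..n}"
  let ?V = "{(x, y) \<in> carrier A1 \<times> carrier A2. \<phi>1 x = \<phi>2 y}"
  \<comment> \<open>These discharge, in order, the six assumptions of the preceding context, once
    for each factor.\<close>
  note ctx1 = assms(1,5,7,10,11,13) and ctx2 = assms(3,5,8,10,12,14)
  have arcs: "(\<exists>z\<in>?S. (x', y') = (x, y) \<otimes>\<^bsub>?P\<^esub> z) \<longleftrightarrow>
      x = x' \<and> (y, y') \<in> parcs ?X2 \<or>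
      (x, x') \<in> parcs ?X1 \<and> \<phi>1 x = \<phi>1 x' \<and> y = y' \<or>
      (x, x') \<in> parcs ?X1 \<and> (\<phi>1 x, \<phi>1 x') \<in> parcs ?Y \<and> (y, y') \<in> parcs ?X2"
    (is "_ \<longleftrightarrow> ?I \<or> ?II \<or> ?III")
    if xy: "(x, y) \<in> ?V" and xy': "(x', y') \<in> ?V" for x y x' y'
  proof -
    have x: "x \<in> carrier A1" and y: "y \<in> carrier A2" and eq: "\<phi>1 x = \<phi>2 y" "\<phi>1 x' = \<phi>2 y'"
      using xy xy' by auto
    have closed: "\<phi>1 x \<in> carrier B"
      using x \<open>\<phi>1 \<in> epi A1 B\<close> by (auto simp: epi_def)
    \<comment> \<open>Both projections agree at the source and at the target, so the two
      translations are compared in \<open>B\<close>: cancelling \<open>\<phi>1 x\<close> leaves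
      \<open>s j = s k\<close>.\<close>
    have same_index: "j = k"
      if j: "j \<in> {1..n}" "x' = x \<otimes>\<^bsub>A1\<^esub> t1 j" and k: "k \<in> {1..n}" "y' = y \<otimes>\<^bsub>A2\<^esub> t2 k" for j k
    proof -
      have "\<phi>1 x \<otimes>\<^bsub>B\<^esub> s j = \<phi>1 x \<otimes>\<^bsub>B\<^esub> s k"
        using section_translate[OF ctx1 x j(1)] section_translate[OF ctx2 y k(1)] j(2) k(2) eq
        by simp
      then have "s j = s k"
        by (rule B.l_cancel)
          (rule closed section_generator(3)[OF ctx1 j(1)] section_generator(3)[OF ctx1 k(1)])+
      then show ?thesis by (rule inj_onD[OF assms(9) _ j(1) k(1)])
    qed
    \<comment> \<open>Type (I) does not say that the arc of the second graph lies in a fibre; this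
      follows from \<open>x = x'\<close> because both pairs lie in the fibre product.\<close>
    have "?I \<longleftrightarrow> x' = x \<and> (\<exists>v\<in>S02. y' = y \<otimes>\<^bsub>A2\<^esub> v)"
      using cayley_graph_arc_in_fibre[OF ctx2, of y y'] y eq by metis
    moreover have "?II \<longleftrightarrow> y' = y \<and> (\<exists>u\<in>S01. x' = x \<otimes>\<^bsub>A1\<^esub> u)"
      using cayley_graph_arc_in_fibre[OF ctx1, of x x'] x by metis
    moreover have "?III \<longleftrightarrow> (\<exists>j\<in>{1..n}. x' = x \<otimes>\<^bsub>A1\<^esub> t1 j \<and> y' = y \<otimes>\<^bsub>A2\<^esub> t2 j)"
    proof -
      \<comment> \<open>By \<open>eq\<close> the single base arc of type (III) is also the
        projection of the pair \<open>y\<close>, \<open>y'\<close>, so the arc characterization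
        applies in each factor separately. The two indices are identified afterwards.\<close>
      have "?III \<longleftrightarrow> (\<exists>j\<in>{1..n}. x' = x \<otimes>\<^bsub>A1\<^esub> t1 j) \<and> (\<exists>k\<in>{1..n}. y' = y \<otimes>\<^bsub>A2\<^esub> t2 k)"
        using cayley_graph_arc_over_arc[OF ctx1, of x x'] cayley_graph_arc_over_arc[OF ctx2, of y y']
          x y eq by metis
      then show ?thesis using same_index by blast
    qed
    moreover have "(\<exists>z\<in>?S. (x', y') = (x, y) \<otimes>\<^bsub>?P\<^esub> z) \<longleftrightarrow>
        x' = x \<and> (\<exists>v\<in>S02. y' = y \<otimes>\<^bsub>A2\<^esub> v) \<or> y' = y \<and> (\<exists>u\<in>S01. x' = x \<otimes>\<^bsub>A1\<^esub> u) \<or>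
        (\<exists>j\<in>{1..n}. x' = x \<otimes>\<^bsub>A1\<^esub> t1 j \<and> y' = y \<otimes>\<^bsub>A2\<^esub> t2 j)"
    proof -
      have mult: "(x, y) \<otimes>\<^bsub>?P\<^esub> (u, v) = (x \<otimes>\<^bsub>A1\<^esub> u, y \<otimes>\<^bsub>A2\<^esub> v)" for u v
        by (simp add: subdirect_group_def)
      have "(\<exists>z\<in>S01 \<times> {\<one>\<^bsub>A2\<^esub>}. (x', y') = (x, y) \<otimes>\<^bsub>?P\<^esub> z) \<longleftrightarrow>
          y' = y \<and> (\<exists>u\<in>S01. x' = x \<otimes>\<^bsub>A1\<^esub> u)"
        using y by (auto simp: mult)
      moreover have "(\<exists>z\<in>{\<one>\<^bsub>A1\<^esub>} \<times> S02. (x', y') = (x, y) \<otimes>\<^bsub>?P\<^esub> z) \<longleftrightarrow>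
          x' = x \<and> (\<exists>v\<in>S02. y' = y \<otimes>\<^bsub>A2\<^esub> v)"
        using x by (auto simp: mult)
      moreover have "(\<exists>z\<in>(\<lambda>j. (t1 j, t2 j)) ` {1..n}. (x', y') = (x, y) \<otimes>\<^bsub>?P\<^esub> z) \<longleftrightarrow>
          (\<exists>j\<in>{1..n}. x' = x \<otimes>\<^bsub>A1\<^esub> t1 j \<and> y' = y \<otimes>\<^bsub>A2\<^esub> t2 j)"
        by (simp add: mult)
      ultimately show ?thesis unfolding bex_Un by blast
    qed
    ultimately show ?thesis by (simp only:)
  qed
  have "cayley_graph ?P ?S = subdirect_graph ?X1 \<phi>1 ?X2 \<phi>2 ?Y"
  proof (rule pair_pre_digraph.equality)
    show "pverts (cayley_graph ?P ?S) = pverts (subdirect_graph ?X1 \<phi>1 ?X2 \<phi>2 ?Y)"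
      by (simp add: cayley_graph_def subdirect_graph_def subdirect_group_def Let_def)
    have "((x, y), (x', y')) \<in> parcs (cayley_graph ?P ?S) \<longleftrightarrow>
        ((x, y), (x', y')) \<in> parcs (subdirect_graph ?X1 \<phi>1 ?X2 \<phi>2 ?Y)" for x y x' y'
    proof -
      have "((x, y), (x', y')) \<in> parcs (cayley_graph ?P ?S) \<longleftrightarrow>
          (x, y) \<in> ?V \<and> (x', y') \<in> ?V \<and> (\<exists>z\<in>?S. (x', y') = (x, y) \<otimes>\<^bsub>?P\<^esub> z)"
        unfolding cayley_graph_def by (simp add: subdirect_group_def)
      moreover have "((x, y), (x', y')) \<in> parcs (subdirect_graph ?X1 \<phi>1 ?X2 \<phi>2 ?Y) \<longleftrightarrow>
          (x, y) \<in> ?V \<and> (x', y') \<in> ?V \<and>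
          (x = x' \<and> (y, y') \<in> parcs ?X2 \<or>
           (x, x') \<in> parcs ?X1 \<and> \<phi>1 x = \<phi>1 x' \<and> y = y' \<or>
           (x, x') \<in> parcs ?X1 \<and> (\<phi>1 x, \<phi>1 x') \<in> parcs ?Y \<and> (y, y') \<in> parcs ?X2)"
        by (simp add: subdirect_graph_def Let_def) (simp add: cayley_graph_def)
      \<comment> \<open>The equivalence \<open>arcs\<close> is conditional on both pairs being
        vertices; \<open>conj_cong\<close> makes these conjuncts available while the last one is
        rewritten.\<close>
      ultimately show ?thesis using arcs[of x y x' y'] by (simp only: cong: conj_cong)
    qed
    then show "parcs (cayley_graph ?P ?S) = parcs (subdirect_graph ?X1 \<phi>1 ?X2 \<phi>2 ?Y)"
      by (simp add: set_eq_iff)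
  qed simp
  then show ?thesis unfolding Let_def .
qed

end
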